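(* Let $q$ be a prime power and let $m,n\in\mathbb{N}$ with $\gcd(n,q)=1$ and $\gcd(m,n)=\gcd(\phi(m),d_n)=1$, where $d_n=\operatorname{ord}_n(q)$. Assume $q$ is a primitive root modulo $m$. Let $\Phi_n=\prod_{i=1}^{\phi(n)/d_n}f_i$ be the factorization of $\Phi_n$ into monic irreducible polynomials over $\mathbb{F}_q$. Then the (complete) factorization of $\Phi_{mn}$ over $\mathbb{F}_q$ is given by $$\Phi_{mn}(x)=\prod_{i=1}^{\phi(n)/d_n}\left(\prod_{d\mid m}\Psi_{i,d}(x^d)^{\mu(m/d)}\right),$$ where each $\Psi_{i,d}$ is the minimal polynomial over $\mathbb{F}_q$ of $\xi_{n,i}^d$, with $\xi_{n,i}$ a root of $f_i$; that is, each of the inner products is an irreducible polynomial over $\mathbb{F}_q$.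
   Context: $\phi$ is Euler's totient function, $\mu$ the Möbius function, $\operatorname{ord}_n(q)$ the multiplicative order of $q$ modulo $n$, and $\Phi_m$ the $m$-th cyclotomic polynomial, regarded over $\mathbb{F}_q$. "$q$ is a primitive root modulo $m$" means $\gcd(q,m)=1$ and $\operatorname{ord}_m(q)=\phi(m)$. When $\gcd(n,q)=1$, $\Phi_n$ is a product of $\phi(n)/\operatorname{ord}_n(q)$ distinct monic irreducible polynomials over $\mathbb{F}_q$, all of degree $\operatorname{ord}_n(q)$. *)

theory Defs
  imports
    Complex_Main
    "HOL-Number_Theory.Number_Theory"
    "HOL-Algebra.Algebraic_Closure_Type"
begin

definition moebius_mu :: "nat \<Rightarrow> int" where
  "moebius_mu n = (if squarefree n then (-1) ^ card (prime_factors n) else 0)"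

text \<open>
  The cyclotomic polynomial is the monic integer polynomial whose complex roots are exactly the
  primitive \<open>n\<close>-th roots of unity \<open>exp (2\<pi>ik/n)\<close>, each one simple. Lemma \<open>cyclotomic_int\<close> below
  shows that the description determines a polynomial.
\<close>

definition cyclotomic_int :: "nat \<Rightarrow> int poly" where
  "cyclotomic_int n = (THE p. map_poly of_int p =
     (\<Prod>k\<in>totatives n. [:- cis (2 * pi * real k / real n), 1:]))"

definition cyclotomic :: "nat \<Rightarrow> 'a :: comm_ring_1 poly" where
  "cyclotomic n = map_poly of_int (cyclotomic_int n)"

text \<open>
  The minimal polynomial over \<open>'a\<close> of an element of the algebraic closure of \<open>'a\<close>; existence and
  uniqueness are shown in lemma \<open>min_poly\<close> below.
\<close>

definition is_min_poly :: "'a :: field alg_closure \<Rightarrow> 'a poly \<Rightarrow> bool" where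
  "is_min_poly x p \<longleftrightarrow> lead_coeff p = 1 \<and> poly (map_poly to_ac p) x = 0 \<and>
     (\<forall>r. r \<noteq> 0 \<and> poly (map_poly to_ac r) x = 0 \<longrightarrow> degree p \<le> degree r)"

definition min_poly :: "'a :: field alg_closure \<Rightarrow> 'a poly" where
  "min_poly x = (THE p. is_min_poly x p)"


lemma degree_diff_less_lead:
  fixes p q :: "'a :: ab_group_add poly"
  assumes "degree p = n" "degree q = n" "lead_coeff p = lead_coeff q" "n \<noteq> 0"
  shows "degree (p - q) < n"
proof -
  have "degree (p - q) \<le> n"
    using degree_diff_le_max [of p q] assms by simp
  moreover have "degree (p - q) \<noteq> n"
  proof
    assume "degree (p - q) = n"
    hence "lead_coeff (p - q) = 0" using assms by simp
    thus False
      using \<open>degree (p - q) = n\<close> assms(4) by (metis degree_0 leading_coeff_0_iff)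
  qed
  ultimately show ?thesis by linarith
qed

lemma map_poly_of_int_mult:
  "map_poly of_int (p * q) = (map_poly of_int p * map_poly of_int q :: 'a :: comm_ring_1 poly)"
  by (intro poly_eqI) (simp add: coeff_map_poly coeff_mult)

lemma map_poly_of_int_add:
  "map_poly of_int (p + q) = (map_poly of_int p + map_poly of_int q :: 'a :: comm_ring_1 poly)"
  by (intro poly_eqI) (simp add: coeff_map_poly)

lemma map_poly_of_int_prod:
  "map_poly of_int (\<Prod>i\<in>A. f i) = (\<Prod>i\<in>A. map_poly of_int (f i) :: 'a :: comm_ring_1 poly)"
  by (induction A rule: infinite_finite_induct) (simp_all add: map_poly_of_int_mult)

lemma complex_cyclotomic_prod:
  assumes "n > 0"
  shows "(\<Prod>d | d dvd n. \<Prod>k\<in>totatives d. [:- cis (2 * pi * real k / real d), 1:]) =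
           monom 1 n - (1 :: complex poly)"
proof -
  define A where "A d = {k\<in>{0<..n}. gcd k n = d}" for d
  define g where "g k = [:- cis (2 * pi * real k / real n), 1:]" for k
  define P :: "complex poly" where "P = (\<Prod>k\<in>{0<..n}. g k)"
  define Q :: "complex poly" where "Q = monom 1 n - 1"
  have inner: "(\<Prod>k\<in>totatives (n div d). [:- cis (2 * pi * real k / real (n div d)), 1:]) =
                 (\<Prod>k\<in>A d. g k)" if d: "d dvd n" for d
  proof -
    have "(\<Prod>k\<in>A d. g k) = (\<Prod>k\<in>totatives (n div d). g (k * d))"
      unfolding A_def
      by (rule prod.reindex_bij_betw [OF bij_betw_totatives_gcd_eq, symmetric]) (use assms d in auto)
    also have "\<dots> = (\<Prod>k\<in>totatives (n div d). [:- cis (2 * pi * real k / real (n div d)), 1:])"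
      using d assms by (intro prod.cong) (auto simp: g_def real_of_nat_div mult.assoc elim!: dvdE)
    finally show ?thesis ..
  qed
  have "(\<Prod>d | d dvd n. \<Prod>k\<in>totatives d. [:- cis (2 * pi * real k / real d), 1:]) =
        (\<Prod>d | d dvd n. \<Prod>k\<in>totatives (n div d). [:- cis (2 * pi * real k / real (n div d)), 1:])"
    by (rule prod.reindex_bij_witness[of _ "(div) n" "(div) n"]) (use assms in \<open>auto elim: dvdE\<close>)
  also have "\<dots> = (\<Prod>d | d dvd n. \<Prod>k\<in>A d. g k)"
    by (intro prod.cong refl inner) auto
  also have "\<dots> = prod g (\<Union>d\<in>{d. d dvd n}. A d)"
    using assms by (intro prod.UNION_disjoint [symmetric]) (auto simp: A_def)
  also have "(\<Union>d\<in>{d. d dvd n}. A d) = {0<..n}"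
    by (auto simp: A_def)
  also have "prod g {0<..n} = P" by (simp add: P_def)
  also have "P = Q"
  proof (rule ccontr)
    assume "P \<noteq> Q"
    have degP: "degree P = n"
      by (simp add: P_def g_def degree_prod_eq_sum_degree)
    have leadP: "lead_coeff P = 1"
      unfolding P_def lead_coeff_prod by (simp add: g_def)
    have "degree Q = degree (monom (1 :: complex) n + (- 1))" by (simp add: Q_def)
    also have "\<dots> = degree (monom (1 :: complex) n)"
      by (rule degree_add_eq_left) (use assms in \<open>simp add: degree_monom_eq\<close>)
    finally have degQ: "degree Q = n" by (simp add: degree_monom_eq)
    have leadQ: "lead_coeff Q = 1"
      unfolding degQ using assms by (simp add: Q_def)
    have "degree (P - Q) < n"
      using \<open>P \<noteq> Q\<close> degP degQ leadP leadQ assms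
      by (intro degree_diff_less_lead) auto
    moreover have "card {x. x ^ n = (1 :: complex)} \<le> degree (P - Q)"
    proof -
      have "{x. x ^ n = (1 :: complex)} \<subseteq> {x. poly (P - Q) x = 0}"
      proof safe
        fix x :: complex assume x: "x ^ n = 1"
        obtain k where k: "k < n" "x = cis (2 * pi * real k / real n)"
          using bij_betw_imp_surj_on [OF bij_betw_roots_unity [OF assms]] x by force
        define j where "j = (if k = 0 then n else k)"
        have "j \<in> {0<..n}" "x = cis (2 * pi * real j / real n)"
          using k assms cis_multiple_2pi[of 1] by (auto simp: j_def)
        hence "poly P x = 0"
          unfolding P_def g_def poly_prod by (intro prod_zero) auto
        moreover have "poly Q x = 0"
          using x by (simp add: Q_def poly_monom)
        ultimately show "poly (P - Q) x = 0" by simp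
      qed
      hence "card {x. x ^ n = (1 :: complex)} \<le> card {x. poly (P - Q) x = 0}"
        using \<open>P \<noteq> Q\<close> by (intro card_mono poly_roots_finite) auto
      also have "\<dots> \<le> degree (P - Q)"
        using \<open>P \<noteq> Q\<close> by (intro card_poly_roots_bound) auto
      finally show ?thesis .
    qed
    ultimately show False
      using card_roots_unity_eq [OF assms] by simp
  qed
  finally show ?thesis by (simp add: Q_def)
qed

lemma cyclotomic_int_exists:
  "\<exists>p. lead_coeff p = 1 \<and> map_poly of_int p =
     (\<Prod>k\<in>totatives n. [:- cis (2 * pi * real k / real n), 1:])"
proof (induction n rule: less_induct)
  case (less n)
  define C where "C d = (\<Prod>k\<in>totatives d. [:- cis (2 * pi * real k / real d), 1:])" for d
  show ?case
  proof (cases "n = 0")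
    case True
    thus ?thesis by (intro exI[of _ 1]) simp
  next
    case False
    define D where "D = {d. d dvd n \<and> d \<noteq> n}"
    have fin: "finite D" and D: "{d. d dvd n} = insert n D" "n \<notin> D"
      using False by (auto simp: D_def)
    have "\<forall>d\<in>D. \<exists>p. lead_coeff p = 1 \<and> map_poly of_int p = C d"
      using less.IH False unfolding C_def D_def
      by (metis (mono_tags, lifting) dvd_imp_le le_neq_implies_less mem_Collect_eq not_gr_zero)
    then obtain f where f: "\<And>d. d \<in> D \<Longrightarrow> lead_coeff (f d) = 1"
        "\<And>d. d \<in> D \<Longrightarrow> map_poly of_int (f d) = C d"
      by metis
    define q where "q = (\<Prod>d\<in>D. f d)"
    have lq: "lead_coeff q = 1" by (simp add: q_def lead_coeff_prod f)
    hence q0: "q \<noteq> 0" by auto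
    have qC: "map_poly of_int q = (\<Prod>d\<in>D. C d)"
      by (simp add: q_def map_poly_of_int_prod f)
    define a r where "a = fst (pseudo_divmod (monom 1 n - 1) q)"
      and "r = snd (pseudo_divmod (monom 1 n - 1) q)"
    have ar: "monom 1 n - 1 = q * a + r" "r = 0 \<or> degree r < degree q"
      using pseudo_divmod [OF q0, of "monom 1 n - 1" a r] lq by (simp_all add: a_def r_def)
    have "map_poly of_int (monom 1 n - 1 :: int poly) = (monom 1 n - 1 :: complex poly)"
      by (intro poly_eqI) (simp add: coeff_map_poly)
    also have "(monom 1 n - 1 :: complex poly) = (\<Prod>d | d dvd n. C d)"
      using complex_cyclotomic_prod [of n] False by (simp add: C_def)
    also have "\<dots> = map_poly of_int q * C n"
      using fin D by (simp add: qC mult.commute)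
    finally have eq: "map_poly of_int q * (C n - map_poly of_int a) = map_poly of_int r"
      unfolding ar(1) by (simp add: map_poly_of_int_mult map_poly_of_int_add algebra_simps)
    have deg: "degree (map_poly of_int p :: complex poly) = degree p" for p
      by (rule degree_map_poly) auto
    have q0': "map_poly of_int q \<noteq> (0 :: complex poly)"
      using q0 by (simp add: map_poly_eq_0_iff)
    have "C n - map_poly of_int a = 0"
    proof (rule ccontr)
      assume nz: "C n - map_poly of_int a \<noteq> 0"
      have "map_poly of_int r \<noteq> (0 :: complex poly)"
        using nz q0' eq by (metis mult_eq_0_iff)
      hence "degree r < degree q" using ar(2) by auto
      moreover have "degree r = degree q + degree (C n - map_poly of_int a)"
        using nz q0' eq by (metis degree_mult_eq deg)
      ultimately show False by simp
    qed
    hence a: "map_poly of_int a = C n" by simp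
    have "of_int (lead_coeff a) = lead_coeff (map_poly of_int a :: complex poly)"
      by (simp add: deg coeff_map_poly)
    also have "\<dots> = 1" by (simp add: a C_def lead_coeff_prod)
    finally have "lead_coeff a = 1" by simp
    with a show ?thesis unfolding C_def by blast
  qed
qed

lemma cyclotomic_int:
  "map_poly of_int (cyclotomic_int n) =
     (\<Prod>k\<in>totatives n. [:- cis (2 * pi * real k / real n), 1:])"
proof -
  have "\<exists>!p. map_poly of_int p = (\<Prod>k\<in>totatives n. [:- cis (2 * pi * real k / real n), 1:])"
  proof (rule ex_ex1I)
    fix p q :: "int poly"
    assume "map_poly of_int p = (\<Prod>k\<in>totatives n. [:- cis (2 * pi * real k / real n), 1:])"
      and "map_poly of_int q = (\<Prod>k\<in>totatives n. [:- cis (2 * pi * real k / real n), 1:])"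
    hence "map_poly of_int p = (map_poly of_int q :: complex poly)" by simp
    thus "p = q" by (simp add: poly_eq_iff coeff_map_poly)
  qed (use cyclotomic_int_exists in blast)
  thus ?thesis unfolding cyclotomic_int_def by (rule theI')
qed

lemma min_poly: "is_min_poly x (min_poly x)"
proof -
  define R where "R p \<longleftrightarrow> p \<noteq> 0 \<and> poly (map_poly to_ac p) x = 0" for p
  obtain p0 where "R p0"
    using alg_closure_algebraic [of x] unfolding R_def by metis
  then obtain p where p: "R p" "\<And>r. R r \<Longrightarrow> degree p \<le> degree r"
    using arg_min_nat_lemma [of R p0 degree] by blast
  have smult: "map_poly to_ac (smult c r) = smult (to_ac c) (map_poly to_ac r)" for c r
    by (rule map_poly_smult) auto
  have diff: "map_poly to_ac (a - b) = map_poly to_ac a - map_poly to_ac b" for a b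
    by (intro poly_eqI) (simp add: coeff_map_poly)
  have "is_min_poly x (smult (inverse (lead_coeff p)) p)"
    using p unfolding is_min_poly_def R_def by (auto simp: smult)
  moreover have "a = b" if "is_min_poly x a" "is_min_poly x b" for a b
  proof (rule ccontr)
    assume "a \<noteq> b"
    have eq: "degree a = degree b" "lead_coeff a = 1" "lead_coeff b = 1"
      and root: "poly (map_poly to_ac (a - b)) x = 0"
      using that unfolding is_min_poly_def
      by (auto simp: diff intro!: antisym) (metis leading_coeff_0_iff zero_neq_one)+
    have "degree a \<noteq> 0"
    proof
      assume "degree a = 0"
      hence "a = 1" "b = 1"
        using eq by (auto elim!: degree_eq_zeroE simp: one_pCons)
      with \<open>a \<noteq> b\<close> show False by simp
    qed
    hence "degree (a - b) < degree a"
      using eq \<open>a \<noteq> b\<close> by (intro degree_diff_less_lead) auto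
    moreover have "degree a \<le> degree (a - b)"
      using that(1) root \<open>a \<noteq> b\<close> unfolding is_min_poly_def by auto
    ultimately show False by simp
  qed
  ultimately show ?thesis
    unfolding min_poly_def by (metis theI')
qed

end

theory Submission
  imports Defs
begin

text \<open>
  Write \<open>P\<^sub>e\<close> for the set of elements of multiplicative order \<open>e\<close> in the algebraic closure. For
  \<open>\<xi> = \<xi>\<^sub>i\<close> with set of conjugates \<open>A = {\<xi>, \<xi>^q, \<xi>^(q^2), \<dots>} \<subseteq> P\<^sub>n\<close>, the conjugates of
  \<open>\<xi>^d\<close> are the \<open>d\<close>-th powers of those of \<open>\<xi>\<close>, so \<open>\<Psi>\<^sub>i\<^sub>,\<^sub>d(x^d)\<close> is the product of
  \<open>x^d - a^d\<close> over \<open>a \<in> A\<close>, that is, of the polynomials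
  \<open>G\<^sub>e = (\<Prod>a\<in>A. \<Prod>b\<in>P\<^sub>e. x - ab)\<close> for \<open>e dvd d\<close>.
  The \<open>G\<^sub>e\<close> are stable under Frobenius and hence have coefficients in the base field, so Moebius
  inversion identifies the inner product with \<open>G\<^sub>m\<close>. As \<open>q\<close> generates the units modulo \<open>m\<close> and
  the two Frobenius orbit lengths \<open>ord n q\<close> and \<open>totient m\<close> are coprime, the Chinese remainder
  theorem for exponents of Frobenius shows that the roots of \<open>G\<^sub>m\<close> are a single Frobenius orbit;
  thus \<open>G\<^sub>m\<close> is a minimal polynomial.
\<close>

subsection \<open>Elements of given multiplicative order\<close>

text \<open>The order is encoded by all exponents that give \<open>1\<close>, so membership turns
  equations between powers directly into divisibility. For \<open>n = 0\<close> the set consists of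
  \<open>0\<close> and the elements of infinite order.\<close>

definition prim_roots :: "nat \<Rightarrow> 'b :: field set" where
  "prim_roots n = {x. \<forall>k. x ^ k = 1 \<longleftrightarrow> n dvd k}"

lemma prim_roots_power_eq_1: "x \<in> prim_roots n \<Longrightarrow> x ^ k = 1 \<longleftrightarrow> n dvd k"
  by (simp add: prim_roots_def)

lemma prim_roots_nonzero: "x \<in> prim_roots n \<Longrightarrow> n > 0 \<Longrightarrow> x \<noteq> 0"
  using prim_roots_power_eq_1[of x n n] by (auto simp: power_0_left)

lemma prim_roots_power_eq_iff:
  assumes "x \<in> prim_roots n" "n > 0"
  shows   "x ^ i = x ^ j \<longleftrightarrow> [i = j] (mod n)"
proof (induction i j rule: linorder_wlog)
  case (le i j)
  then obtain k where j: "j = i + k" using le_Suc_ex by blast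
  have "x ^ i = x ^ j \<longleftrightarrow> x ^ k = 1"
    using prim_roots_nonzero[OF assms] by (simp add: j power_add)
  also have "\<dots> \<longleftrightarrow> [i = j] (mod n)"
    using cong_add_lcancel_nat[of i 0 k n]
    by (simp add: j prim_roots_power_eq_1[OF assms(1)] cong_0_iff cong_sym_eq[of 0 k])
  finally show ?case .
qed (auto simp: cong_sym_eq)

lemma prim_roots_power:
  assumes "x \<in> prim_roots n" "coprime n d"
  shows   "x ^ d \<in> prim_roots n"
  using assms by (auto simp: prim_roots_def coprime_dvd_mult_right_iff simp flip: power_mult)

text \<open>An inverse \<open>s\<close> of \<open>d\<close> modulo \<open>n\<close> recovers
  \<open>x\<close> as \<open>(x ^ d) ^ s\<close>.\<close>

lemma inj_on_power_prim_roots: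
  assumes "coprime n d" "n > 0"
  shows   "inj_on (\<lambda>x. x ^ d) (prim_roots n :: 'b :: field set)"
proof (rule inj_onI)
  fix x y :: 'b assume xy: "x \<in> prim_roots n" "y \<in> prim_roots n" "x ^ d = y ^ d"
  obtain s where s: "[d * s = 1] (mod n)"
    using cong_solve_coprime_nat assms(1) by (metis coprime_commute One_nat_def)
  have "x = x ^ (d * s)" "y = y ^ (d * s)"
    using prim_roots_power_eq_iff[of x n "d * s" 1] prim_roots_power_eq_iff[of y n "d * s" 1] s xy assms(2)
    by simp_all
  with xy(3) show "x = y" by (metis power_mult)
qed

lemma prim_roots_disjoint:
  assumes "x \<in> prim_roots m" "x \<in> prim_roots n"
  shows   "m = n"
proof -
  from assms have "m dvd k \<longleftrightarrow> n dvd k" for k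
    by (simp flip: prim_roots_power_eq_1[of x])
  from this[of m] this[of n] show ?thesis by (simp add: dvd_antisym)
qed

text \<open>The order of a root of unity is its least positive exponent; division with remainder
  shows that it divides every other one.\<close>

lemma roots_unity_eq_UN_prim_roots:
  assumes "n > 0"
  shows   "{x :: 'b :: field. x ^ n = 1} = (\<Union>d\<in>{d. d dvd n}. prim_roots d)"
proof (intro equalityI subsetI)
  fix x :: 'b assume x: "x \<in> {x. x ^ n = 1}"
  define d where "d = (LEAST k. k > 0 \<and> x ^ k = 1)"
  have d: "d > 0" "x ^ d = 1"
    using LeastI[of "\<lambda>k. k > 0 \<and> x ^ k = 1" n] x assms by (auto simp: d_def)
  have "x ^ k = 1 \<longleftrightarrow> d dvd k" for k
  proof
    assume k: "x ^ k = 1"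
    have "x ^ k = x ^ (d * (k div d) + k mod d)" by simp
    also have "\<dots> = x ^ (k mod d)" using d by (simp only: power_add power_mult) simp
    finally have "x ^ (k mod d) = 1" using k by simp
    moreover have "k mod d < d" using d by simp
    ultimately have "k mod d = 0"
      using not_less_Least[of "k mod d" "\<lambda>k. k > 0 \<and> x ^ k = 1"] unfolding d_def by auto
    thus "d dvd k" by auto
  qed (use d in \<open>auto simp: power_mult elim!: dvdE\<close>)
  with x show "x \<in> (\<Union>d\<in>{d. d dvd n}. prim_roots d)"
    by (auto simp: prim_roots_def)
qed (auto simp: prim_roots_def)

text \<open>Separability: a multiple root would also be a root of the derivative
  \<open>n * x ^ (n - 1)\<close>, hence \<open>0\<close> as \<open>n\<close> is invertible, but
  \<open>0\<close> is no root because \<open>c\<close> is nonzero.\<close>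

lemma monom_minus_const_eq_prod:
  fixes c :: "'b :: alg_closed_field"
  assumes "of_nat n \<noteq> (0 :: 'b)" "c \<noteq> 0"
  shows   "finite {y. y ^ n = c}" and "monom 1 n - [:c:] = (\<Prod>y | y ^ n = c. [:-y, 1:])"
proof -
  define p where "p = monom 1 n - [:c:]"
  have n: "n > 0" using assms(1) by (intro Nat.gr0I) auto
  have "coeff p n = 1" using n by (cases n) (auto simp: p_def coeff_pCons)
  moreover have "degree p \<le> n"
    unfolding p_def by (intro degree_diff_le degree_monom_le) auto
  ultimately have deg: "degree p = n" and lead: "lead_coeff p = 1"
    by (metis le_antisym le_degree one_neq_zero)+
  have "p \<noteq> 0" using lead by auto
  then obtain A where A: "p = (\<Prod>x\<in>#A. [:-x, 1:])"
    using alg_closed_imp_factorization[of p] lead by auto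
  have poly_p: "poly p x = x ^ n - c" for x by (simp add: p_def poly_monom)
  have root: "poly p x = 0 \<longleftrightarrow> x \<in># A" for x
    unfolding A by (induction A) auto
  have "count A x \<le> 1" for x
  proof (rule ccontr)
    assume "\<not> count A x \<le> 1"
    hence "2 \<le> count A x" by simp
    hence "{#x, x#} \<subseteq># A"
      by (auto simp: subseteq_mset_def)
    then obtain B where B: "A = {#x, x#} + B" by (metis subset_mset.add_diff_inverse)
    have "p = [:-x, 1:] * ([:-x, 1:] * (\<Prod>x\<in>#B. [:-x, 1:]))"
      unfolding A B by (simp add: mult.assoc)
    hence "poly (pderiv p) x = 0" by (simp only: pderiv_mult) simp
    hence "of_nat n * x ^ (n - 1) = 0"
      by (simp add: p_def pderiv_diff pderiv_monom poly_monom pderiv_pCons)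
    hence "x = 0" using assms(1) by simp
    moreover have "x ^ n = c" using root[of x] B poly_p[of x] by auto
    ultimately show False using assms(2) n by (simp add: power_0_left split: if_splits)
  qed
  \<comment> \<open>With all multiplicities at most one, the multiset of roots is a set, and the
    product over \<open>A\<close> becomes a product over that set.\<close>
  hence "A = mset_set (set_mset A)"
    by (intro multiset_eqI) (metis count_mset_set(1,3) finite_set_mset not_in_iff le_antisym
        count_greater_eq_one_iff)
  moreover have set: "set_mset A = {y. y ^ n = c}" using root poly_p by auto
  ultimately have "p = (\<Prod>y | y ^ n = c. [:-y, 1:])"
    using A by (metis prod_unfold_prod_mset)
  thus "monom 1 n - [:c:] = (\<Prod>y | y ^ n = c. [:-y, 1:])" by (simp add: p_def)
  show "finite {y. y ^ n = c}" unfolding set[symmetric] by simp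
qed

lemma of_nat_dvd_nonzero:
  "d dvd n \<Longrightarrow> of_nat n \<noteq> (0 :: 'b :: semiring_1) \<Longrightarrow> of_nat d \<noteq> (0 :: 'b)"
  by (auto elim!: dvdE)

lemma finite_prim_roots:
  assumes "of_nat n \<noteq> (0 :: 'b :: alg_closed_field)"
  shows   "finite (prim_roots n :: 'b set)"
  by (rule finite_subset[OF _ monom_minus_const_eq_prod(1)[OF assms, of 1]])
     (use prim_roots_power_eq_1[of _ n n] in auto)

text \<open>The \<open>n\<close>-th roots of \<open>a ^ n\<close> are the multiples of
  \<open>a\<close> by \<open>n\<close>-th roots of unity, here grouped by the order of the root of
  unity.\<close>

lemma monom_minus_power_eq_prod_prim_roots:
  fixes a :: "'b :: alg_closed_field"
  assumes "of_nat n \<noteq> (0 :: 'b)" "a \<noteq> 0"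
  shows   "monom 1 n - [:a ^ n:] = (\<Prod>d | d dvd n. \<Prod>b\<in>prim_roots d. [:-(a * b), 1:])"
proof -
  have n: "n > 0" using assms(1) by (intro Nat.gr0I) auto
  have "(\<Prod>d | d dvd n. \<Prod>b\<in>prim_roots d. [:-(a * b), 1:]) =
        (\<Prod>b\<in>(\<Union>d\<in>{d. d dvd n}. prim_roots d). [:-(a * b), 1:])"
    by (rule prod.UNION_disjoint[symmetric])
       (use n in \<open>auto intro!: finite_prim_roots[OF of_nat_dvd_nonzero[OF _ assms(1)]] dest: prim_roots_disjoint\<close>)
  also have "\<dots> = (\<Prod>b | b ^ n = 1. [:-(a * b), 1:])"
    using roots_unity_eq_UN_prim_roots[OF n] by metis
  also have "\<dots> = (\<Prod>y | y ^ n = a ^ n. [:-y, 1:])"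
    by (rule prod.reindex_bij_witness[of _ "\<lambda>y. y / a" "\<lambda>b. a * b"])
       (use assms in \<open>auto simp: power_divide power_mult_distrib\<close>)
  also have "\<dots> = monom 1 n - [:a ^ n:]"
    using assms by (intro monom_minus_const_eq_prod(2)[symmetric]) auto
  finally show ?thesis ..
qed

section \<open>Cyclotomic polynomials over arbitrary rings and fields\<close>

lemma degree_cyclotomic_int: "degree (cyclotomic_int n) = totient n"
  and lead_coeff_cyclotomic_int: "lead_coeff (cyclotomic_int n) = 1"
proof -
  have deg: "degree (map_poly of_int p :: complex poly) = degree p" for p
    by (rule degree_map_poly) auto
  show "degree (cyclotomic_int n) = totient n"
    unfolding deg[symmetric] cyclotomic_int
    by (simp add: degree_prod_eq_sum_degree totient_def)
  have "of_int (lead_coeff (cyclotomic_int n)) =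
        lead_coeff (map_poly of_int (cyclotomic_int n) :: complex poly)"
    by (simp add: deg coeff_map_poly)
  also have "\<dots> = 1" by (simp add: cyclotomic_int lead_coeff_prod)
  finally show "lead_coeff (cyclotomic_int n) = 1" by simp
qed

text \<open>Reducing integer coefficients can lower a degree in general; here it cannot, because the
  top coefficient is \<open>1\<close>.\<close>

lemma lead_coeff_cyclotomic: "lead_coeff (cyclotomic n :: 'b :: comm_ring_1 poly) = 1"
  and degree_cyclotomic: "degree (cyclotomic n :: 'b :: comm_ring_1 poly) = totient n"
proof -
  have "coeff (cyclotomic n :: 'b poly) (totient n) = 1"
    using lead_coeff_cyclotomic_int[of n] degree_cyclotomic_int[of n]
    by (simp add: cyclotomic_def coeff_map_poly)
  moreover have "degree (cyclotomic n :: 'b poly) \<le> totient n"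
    by (rule degree_le) (simp add: cyclotomic_def coeff_map_poly coeff_eq_0 degree_cyclotomic_int)
  ultimately show "degree (cyclotomic n :: 'b poly) = totient n"
    by (metis le_antisym le_degree one_neq_zero)
  with \<open>coeff _ _ = 1\<close> show "lead_coeff (cyclotomic n :: 'b poly) = 1" by simp
qed

lemma cyclotomic_nonzero: "cyclotomic n \<noteq> (0 :: 'b :: comm_ring_1 poly)"
  using lead_coeff_cyclotomic[of n, where ?'b = 'b] by auto

text \<open>The complex identity descends to the integers by injectivity of \<open>of_int\<close>,
  and from there maps to every commutative ring.\<close>

lemma prod_cyclotomic:
  assumes "n > 0"
  shows   "(\<Prod>d | d dvd n. cyclotomic d) = (monom 1 n - 1 :: 'b :: comm_ring_1 poly)"
proof -
  have "map_poly of_int (\<Prod>d | d dvd n. cyclotomic_int d) = (monom 1 n - 1 :: complex poly)"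
    using complex_cyclotomic_prod[OF assms] by (simp add: map_poly_of_int_prod cyclotomic_int)
  also have "\<dots> = map_poly of_int (monom 1 n - 1)"
    by (intro poly_eqI) (simp add: coeff_map_poly)
  finally have "(\<Prod>d | d dvd n. cyclotomic_int d) = monom 1 n - 1"
    by (intro poly_eqI) (metis (mono_tags, lifting) coeff_map_poly of_int_0 of_int_eq_iff)
  from arg_cong[OF this, of "map_poly of_int :: _ \<Rightarrow> 'b poly"] show ?thesis
    by (simp add: map_poly_of_int_prod cyclotomic_def) 
       (auto intro!: poly_eqI simp: coeff_map_poly)
qed

text \<open>Bridge from the complex definition to the closure of a finite field. Both sides,
  multiplied over the divisors of \<open>n\<close>, give \<open>x^n - 1\<close>; by induction the
  factors for proper divisors agree and cancel.\<close>

lemma cyclotomic_eq_prod_prim_roots: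
  assumes "of_nat n \<noteq> (0 :: 'b :: alg_closed_field)"
  shows   "cyclotomic n = (\<Prod>x\<in>prim_roots n. [:-x, 1 :: 'b:])"
  using assms
proof (induction n rule: less_induct)
  case (less n)
  define D where "D = {d. d dvd n \<and> d \<noteq> n}"
  have n: "n > 0" using less.prems by (intro Nat.gr0I) auto
  have D: "{d. d dvd n} = insert n D" "n \<notin> D" "finite D" using n by (auto simp: D_def)
  have "cyclotomic n * (\<Prod>d\<in>D. cyclotomic d) = (\<Prod>d | d dvd n. cyclotomic d :: 'b poly)"
    using D by simp
  also have "\<dots> = monom 1 n - [:1 ^ n:]"
    using prod_cyclotomic[OF n] by (simp add: one_pCons)
  also have "\<dots> = (\<Prod>d | d dvd n. \<Prod>x\<in>prim_roots d. [:-x, 1:])"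
    using monom_minus_power_eq_prod_prim_roots[of n 1] less.prems by simp
  also have "\<dots> = (\<Prod>x\<in>prim_roots n. [:-x, 1:]) * (\<Prod>d\<in>D. \<Prod>x\<in>prim_roots d. [:-x, 1:])"
    using D by simp
  also have "(\<Prod>d\<in>D. \<Prod>x\<in>prim_roots d. [:-x, 1 :: 'b:]) = (\<Prod>d\<in>D. cyclotomic d)"
    using n of_nat_dvd_nonzero[OF _ less.prems]
    by (intro prod.cong refl less.IH[symmetric]) (auto simp: D_def dvd_imp_le le_neq_implies_less)
  finally show ?case
    using D(3) cyclotomic_nonzero[where ?'b = 'b] by simp
qed

lemma card_prim_roots:
  assumes "of_nat n \<noteq> (0 :: 'b :: alg_closed_field)"
  shows   "card (prim_roots n :: 'b set) = totient n"
  using degree_cyclotomic[of n, where ?'b = 'b]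
  by (simp add: cyclotomic_eq_prod_prim_roots[OF assms] degree_prod_eq_sum_degree)

text \<open>Suitable powers of a product recover its two factors, which gives injectivity;
  surjectivity then follows by counting, as \<open>totient\<close> is multiplicative.\<close>

lemma bij_betw_times_prim_roots:
  assumes "of_nat (n * m) \<noteq> (0 :: 'b :: alg_closed_field)" "coprime n m"
  shows   "bij_betw (\<lambda>(a, b). a * b) (prim_roots n \<times> prim_roots m) (prim_roots (n * m) :: 'b set)"
proof -
  have nz: "of_nat n \<noteq> (0 :: 'b)" "of_nat m \<noteq> (0 :: 'b)" using assms(1) by auto
  hence pos: "n > 0" "m > 0" by (auto intro!: Nat.gr0I)
  \<comment> \<open>The exponents \<open>s\<close> and \<open>t\<close> act as projections:
    \<open>s\<close> keeps the factor of order \<open>n\<close> and kills the one of order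
    \<open>m\<close>, and \<open>t\<close> does the reverse.\<close>
  obtain s where s: "[s = 1] (mod n)" "[s = 0] (mod m)"
    using binary_chinese_remainder_nat[OF assms(2)] by blast
  obtain t where t: "[t = 0] (mod n)" "[t = 1] (mod m)"
    using binary_chinese_remainder_nat[OF assms(2)] by blast
  have S: "(a * b) ^ s = a" and T: "(a * b) ^ t = b"
    if "a \<in> prim_roots n" "b \<in> prim_roots m" for a b :: 'b
    using prim_roots_power_eq_iff[OF that(1) pos(1), of s 1]
          prim_roots_power_eq_iff[OF that(2) pos(2), of s 0]
          prim_roots_power_eq_iff[OF that(1) pos(1), of t 0]
          prim_roots_power_eq_iff[OF that(2) pos(2), of t 1] s t
    by (simp_all add: power_mult_distrib)
  have inj: "inj_on (\<lambda>(a, b). a * b) (prim_roots n \<times> prim_roots m :: ('b \<times> 'b) set)"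
  proof (rule inj_onI, clarify)
    fix a b a' b' :: 'b
    assume "a \<in> prim_roots n" "b \<in> prim_roots m" "a' \<in> prim_roots n" "b' \<in> prim_roots m" "a * b = a' * b'"
    thus "a = a' \<and> b = b'" using S[of a b] S[of a' b'] T[of a b] T[of a' b'] by simp
  qed
  have "a * b \<in> prim_roots (n * m)" if ab: "a \<in> prim_roots n" "b \<in> prim_roots m" for a b :: 'b
  proof -
    have "n * m dvd k" if "(a * b) ^ k = 1" for k
    proof -
      have "((a * b) ^ k) ^ i = ((a * b) ^ i) ^ k" for i
        by (simp only: power_mult[symmetric] mult.commute)
      hence "a ^ k = ((a * b) ^ k) ^ s" "b ^ k = ((a * b) ^ k) ^ t"
        using S[OF ab] T[OF ab] by simp_all
      with that have "a ^ k = 1" "b ^ k = 1" by simp_all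
      thus ?thesis using ab assms(2) by (simp add: prim_roots_power_eq_1 divides_mult)
    qed
    moreover have "(a * b) ^ k = 1" if "n * m dvd k" for k
    proof -
      have "a ^ k = 1" "b ^ k = 1"
        using dvd_mult_left[OF that] dvd_mult_right[OF that]
          prim_roots_power_eq_1[OF ab(1)] prim_roots_power_eq_1[OF ab(2)] by simp_all
      thus ?thesis by (simp add: power_mult_distrib)
    qed
    ultimately show ?thesis unfolding prim_roots_def by blast
  qed
  hence sub: "(\<lambda>(a, b). a * b) ` (prim_roots n \<times> prim_roots m) \<subseteq> (prim_roots (n * m) :: 'b set)"
    by auto
  have "card ((\<lambda>(a, b). a * b) ` (prim_roots n \<times> prim_roots m) :: 'b set) = card (prim_roots (n * m) :: 'b set)"
    using card_image[OF inj] nz assms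
    by (simp add: card_cartesian_product card_prim_roots totient_mult_coprime)
  hence "(\<lambda>(a, b). a * b) ` (prim_roots n \<times> prim_roots m) = (prim_roots (n * m) :: 'b set)"
    using sub finite_prim_roots[OF assms(1)] by (metis card_subset_eq)
  with inj show ?thesis by (simp add: bij_betw_def)
qed

subsection \<open>Polynomials over the algebraic closure\<close>

lemma map_poly_to_ac_add:
  "map_poly to_ac (p + r) = map_poly to_ac p + map_poly to_ac r"
  by (intro poly_eqI) (simp add: coeff_map_poly)

lemma map_poly_to_ac_diff:
  "map_poly to_ac (p - r) = map_poly to_ac p - map_poly to_ac r"
  by (intro poly_eqI) (simp add: coeff_map_poly)

lemma map_poly_to_ac_mult:
  "map_poly to_ac (p * r) = map_poly to_ac p * map_poly to_ac r"
  by (intro poly_eqI) (simp add: coeff_map_poly coeff_mult to_ac_sum)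

lemma map_poly_to_ac_prod:
  "map_poly to_ac (\<Prod>i\<in>A. f i) = (\<Prod>i\<in>A. map_poly to_ac (f i))"
  by (induction A rule: infinite_finite_induct) (simp_all add: map_poly_to_ac_mult)

lemma degree_map_poly_to_ac [simp]: "degree (map_poly to_ac p) = degree p"
  by (rule degree_map_poly) auto

lemma map_poly_to_ac_eq_iff [simp]: "map_poly to_ac p = map_poly to_ac r \<longleftrightarrow> p = r"
  by (auto simp: poly_eq_iff coeff_map_poly)

lemma map_poly_to_ac_eq_0_iff [simp]: "map_poly to_ac p = 0 \<longleftrightarrow> p = 0"
  using map_poly_to_ac_eq_iff[of p 0] by simp

lemma map_poly_to_ac_pcompose_monom:
  "map_poly to_ac (pcompose p (monom 1 d)) = pcompose (map_poly to_ac p) (monom 1 d)"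
proof (induction p)
  case (pCons a p)
  thus ?case
    by (simp add: pcompose_pCons map_poly_pCons map_poly_to_ac_add map_poly_to_ac_mult map_poly_monom)
qed auto

lemma map_poly_to_ac_cyclotomic: "map_poly to_ac (cyclotomic n) = cyclotomic n"
  by (intro poly_eqI) (simp add: cyclotomic_def coeff_map_poly)

subsection \<open>Descent from the algebraic closure of a finite field\<close>

text \<open>Multiplication by a nonzero \<open>x\<close> permutes the nonzero elements, so comparing
  their products gives Fermat's little theorem.\<close>

lemma power_card_field:
  fixes x :: "'a :: {field, finite}"
  shows "x ^ card (UNIV :: 'a set) = x"
proof (cases "x = 0")
  case False
  define U where "U = UNIV - {0 :: 'a}"
  have "bij_betw ((*) x) U U"
    using False by (intro bij_betwI[of _ _ _ "\<lambda>y. y / x"]) (auto simp: U_def)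
  hence "(\<Prod>y\<in>U. x * y) = \<Prod>U" by (rule prod.reindex_bij_betw)
  hence "x ^ card U = 1" by (simp add: U_def prod.distrib)
  moreover have "card (UNIV :: 'a set) = Suc (card U)"
    by (simp add: U_def card_Diff_singleton) (metis Suc_pred finite_UNIV_card_ge_0 finite)
  ultimately show ?thesis by simp
qed (use finite_UNIV_card_ge_0[where ?'a = 'a] in auto)

text \<open>The parameter \<open>ty\<close> makes the field \<open>'a\<close> itself a parameter,
  which the number \<open>Q\<close> cannot do.\<close>

locale finite_field_closure =
  fixes Q :: nat and ty :: "'a :: {field, finite} itself"
  assumes primepow_Q: "primepow Q" and Q_def: "Q = card (UNIV :: 'a set)"
begin

lemma Q_gt_1: "Q > 1"
  using primepow_gt_Suc_0[OF primepow_Q] by simp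

lemma Q_eq_power_CHAR:
  obtains k where "Q = CHAR('a) ^ k" "Factorial_Ring.prime CHAR('a)"
proof -
  obtain p k where pk: "Factorial_Ring.prime p" "Q = p ^ k"
    using primepow_Q by (auto simp: primepow_def)
  have "Factorial_Ring.prime CHAR('a)"
    using finite_imp_CHAR_pos[where ?'a = 'a] prime_CHAR_semidom[where ?'a = 'a] by simp
  moreover have "CHAR('a) dvd p ^ k"
    using CHAR_dvd_CARD[where ?'a = 'a] pk Q_def by simp
  ultimately have "CHAR('a) = p"
    using pk(1) by (meson prime_dvd_power primes_dvd_imp_eq)
  with pk that show ?thesis by blast
qed

text \<open>The characteristic divides \<open>Q\<close>, so it cannot divide \<open>n\<close>. This
  supplies the separability hypothesis of the results on roots of unity.\<close>

lemma of_nat_nonzero: "coprime n Q \<Longrightarrow> of_nat n \<noteq> (0 :: 'a alg_closure)"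
proof
  assume *: "coprime n Q" "of_nat n = (0 :: 'a alg_closure)"
  obtain k where k: "Q = CHAR('a) ^ k" "Factorial_Ring.prime CHAR('a)" by (rule Q_eq_power_CHAR)
  hence "k > 0" using Q_gt_1 by (intro Nat.gr0I) auto
  hence "CHAR('a) dvd Q" using k by simp
  moreover have "CHAR('a) dvd n" using *(2) by (simp add: of_nat_eq_0_iff_char_dvd)
  ultimately show False using *(1) k(2) by (meson coprime_common_divisor not_prime_unit)
qed

section \<open>The Frobenius map and its fixed field\<close>

lemma frob_sum: "(\<Sum>i\<in>I. f i :: 'a alg_closure) ^ Q = (\<Sum>i\<in>I. f i ^ Q)"
proof -
  obtain k where k: "Q = CHAR('a) ^ k" "Factorial_Ring.prime CHAR('a)" by (rule Q_eq_power_CHAR)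
  show ?thesis by (rule freshmans_dream_sum'[where n = k]) (use k in simp_all)
qed

lemma frob_add: "(x + y :: 'a alg_closure) ^ Q = x ^ Q + y ^ Q"
  using frob_sum[of "\<lambda>b. if b then x else y" UNIV] by (simp add: UNIV_bool add.commute)

text \<open>Deduced from additivity, which avoids a case distinction on the parity of
  \<open>Q\<close>.\<close>

lemma frob_minus: "(- x :: 'a alg_closure) ^ Q = - (x ^ Q)"
  using frob_add[of x "-x"] Q_gt_1 by (simp add: power_0_left eq_neg_iff_add_eq_0 add.commute)

lemma frob_inj: "(x :: 'a alg_closure) ^ Q = y ^ Q \<Longrightarrow> x = y"
  using frob_add[of x "-y"] Q_gt_1 by (simp add: frob_minus)

lemma frob_to_ac [simp]: "to_ac (x :: 'a) ^ Q = to_ac x"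
  using power_card_field[of x] Q_def by (simp flip: to_ac_power)

text \<open>The fixed points of Frobenius are the roots of \<open>x^Q - x\<close>, at most
  \<open>Q\<close> in number, and the embedded base field already provides \<open>Q\<close> of
  them.\<close>

lemma range_to_ac: "range (to_ac :: 'a \<Rightarrow> _) = {x. x ^ Q = x}"
proof (rule card_seteq)
  define p :: "'a alg_closure poly" where "p = monom 1 Q - monom 1 1"
  have "coeff p Q = 1" using Q_gt_1 by (simp add: p_def)
  hence "p \<noteq> 0" by auto
  have eq: "{x :: 'a alg_closure. x ^ Q = x} = {x. poly p x = 0}"
    by (simp add: p_def poly_monom)
  show "finite {x :: 'a alg_closure. x ^ Q = x}"
    unfolding eq using \<open>p \<noteq> 0\<close> by (rule poly_roots_finite)
  have "card {x :: 'a alg_closure. x ^ Q = x} \<le> degree p"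
    unfolding eq using \<open>p \<noteq> 0\<close> by (rule card_poly_roots_bound)
  also have "\<dots> \<le> Q"
    unfolding p_def using Q_gt_1
    by (intro degree_diff_le order.trans[OF degree_monom_le]) auto
  also have "Q = card (range (to_ac :: 'a \<Rightarrow> _))"
    using card_image[OF inj_to_ac[where ?'a = 'a]] Q_def by simp
  finally show "card {x :: 'a alg_closure. x ^ Q = x} \<le> card (range (to_ac :: 'a \<Rightarrow> _))" .
qed auto

lemma poly_frob:
  "poly (map_poly to_ac (p :: 'a poly)) (x ^ Q) = poly (map_poly to_ac p) x ^ Q"
proof (induction p)
  case (pCons a p)
  thus ?case by (simp add: map_poly_pCons frob_add power_mult_distrib)
qed (use Q_gt_1 in auto)

lemma coeff_map_frob: "coeff (map_poly (\<lambda>x :: 'a alg_closure. x ^ Q) p) i = coeff p i ^ Q"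
  using Q_gt_1 by (simp add: coeff_map_poly power_0_left)

lemma map_frob_mult:
  "map_poly (\<lambda>x :: 'a alg_closure. x ^ Q) (p * r) = map_poly (\<lambda>x. x ^ Q) p * map_poly (\<lambda>x. x ^ Q) r"
  by (intro poly_eqI) (simp add: coeff_map_frob coeff_mult frob_sum power_mult_distrib)

lemma map_frob_prod_linear:
  "map_poly (\<lambda>x :: 'a alg_closure. x ^ Q) (\<Prod>i\<in>I. [:-g i, 1:]) = (\<Prod>i\<in>I. [:-(g i ^ Q), 1:])"
  using Q_gt_1 by (induction I rule: infinite_finite_induct)
    (simp_all add: map_frob_mult map_poly_pCons frob_minus del: mult_pCons_left mult_pCons_right)

lemma descend_poly:
  assumes "map_poly (\<lambda>x. x ^ Q) P = P"
  shows   "\<exists>p :: 'a poly. map_poly to_ac p = P"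
proof -
  have "coeff P i \<in> range to_ac" for i
    unfolding range_to_ac using coeff_map_frob[of P i] assms by simp
  hence "map_poly to_ac (map_poly of_ac P) = P"
    by (intro poly_eqI) (simp add: coeff_map_poly to_ac_of_ac)
  thus ?thesis by blast
qed

text \<open>Frobenius only permutes the linear factors. An indexed family is used so that
  \<open>g\<close> may repeat values.\<close>

lemma descend_prod_linear:
  fixes g :: "'i \<Rightarrow> 'a alg_closure"
  assumes "bij_betw \<sigma> I I" "\<And>i. i \<in> I \<Longrightarrow> g (\<sigma> i) = g i ^ Q"
  shows   "\<exists>p :: 'a poly. map_poly to_ac p = (\<Prod>i\<in>I. [:-g i, 1:])"
proof (rule descend_poly)
  have "(\<Prod>i\<in>I. [:-(g i ^ Q), 1:]) = (\<Prod>i\<in>I. [:-g (\<sigma> i), 1:])"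
    using assms(2) by (intro prod.cong) auto
  also have "\<dots> = (\<Prod>i\<in>I. [:-g i, 1:])"
    by (rule prod.reindex_bij_betw[OF assms(1)])
  finally show "map_poly (\<lambda>x. x ^ Q) (\<Prod>i\<in>I. [:-g i, 1:]) = (\<Prod>i\<in>I. [:-g i, 1:])"
    by (simp only: map_frob_prod_linear)
qed

section \<open>Frobenius orbits, which are the Galois conjugates over \<open>'a\<close>, and minimal
  polynomials\<close>

definition conjugates :: "'a alg_closure \<Rightarrow> 'a alg_closure set" where
  "conjugates x = range (\<lambda>j. x ^ (Q ^ j))"

lemma self_in_conjugates: "x \<in> conjugates x"
  unfolding conjugates_def by (rule range_eqI[of _ _ 0]) simp

lemma conjugates_frob: "y \<in> conjugates x \<Longrightarrow> y ^ Q \<in> conjugates x"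
  by (auto simp: conjugates_def mult.commute simp flip: power_mult power_Suc)

text \<open>Induction along the orbit, applied below to root sets, to \<open>prim_roots\<close> and
  to sets of products.\<close>

lemma conjugates_subset:
  assumes "x \<in> S" "\<And>y. y \<in> S \<Longrightarrow> y ^ Q \<in> S"
  shows   "conjugates x \<subseteq> S"
proof -
  have "x ^ (Q ^ j) \<in> S" for j
  proof (induction j)
    case (Suc j)
    have "x ^ (Q ^ Suc j) = (x ^ (Q ^ j)) ^ Q"
      by (simp add: mult.commute flip: power_mult)
    thus ?case using assms(2)[OF Suc] by simp
  qed (use assms in simp)
  thus ?thesis by (auto simp: conjugates_def)
qed

lemma conjugates_root:
  assumes "poly (map_poly to_ac p) x = 0" "y \<in> conjugates x"
  shows   "poly (map_poly to_ac p) y = 0"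
  using conjugates_subset[of x "{y. poly (map_poly to_ac p) y = 0}"] assms Q_gt_1
  by (auto simp: poly_frob)

lemma finite_conjugates: "finite (conjugates x)"
proof -
  obtain p :: "'a poly" where "p \<noteq> 0" "poly (map_poly to_ac p) x = 0"
    by (rule alg_closure_algebraic)
  thus ?thesis
    using conjugates_root by (intro finite_subset[OF _ poly_roots_finite[of "map_poly to_ac p"]]) auto
qed

lemma card_conjugates_pos: "card (conjugates x) > 0"
  using self_in_conjugates finite_conjugates by (auto simp: card_gt_0_iff)

text \<open>A polynomial over the base field that vanishes at \<open>x\<close> vanishes on the whole
  orbit. This degree bound drives both minimality and irreducibility.\<close>

lemma card_conjugates_le:
  assumes "poly (map_poly to_ac p) x = 0" "p \<noteq> 0"
  shows   "card (conjugates x) \<le> degree p"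
proof -
  have "card (conjugates x) \<le> card {y. poly (map_poly to_ac p) y = 0}"
    using assms conjugates_root by (intro card_mono poly_roots_finite) auto
  also have "\<dots> \<le> degree (map_poly to_ac p)"
    using assms by (intro card_poly_roots_bound) auto
  finally show ?thesis by simp
qed

lemma bij_betw_frob:
  assumes "finite S" "\<And>y. y \<in> S \<Longrightarrow> y ^ Q \<in> S"
  shows   "bij_betw (\<lambda>y :: 'a alg_closure. y ^ Q) S S"
proof -
  have inj: "inj_on (\<lambda>y. y ^ Q) S" by (rule inj_onI) (rule frob_inj)
  moreover have "(\<lambda>y. y ^ Q) ` S \<subseteq> S" using assms(2) by (rule image_subsetI)
  ultimately show ?thesis using endo_inj_surj[OF assms(1)] by (simp add: bij_betw_def)
qed

text \<open>The orbit product descends to the base field and attains the degree bound. A different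
  monic polynomial of that degree vanishing at \<open>x\<close> would leave a nonzero difference of
  smaller degree that still vanishes there.\<close>

lemma min_poly_eq_prod_conjugates:
  "map_poly to_ac (min_poly x) = (\<Prod>y\<in>conjugates x. [:-y, 1:])"
proof -
  obtain p :: "'a poly" where p: "map_poly to_ac p = (\<Prod>y\<in>conjugates x. [:-y, 1:])"
    using descend_prod_linear[OF bij_betw_frob, of "conjugates x" "\<lambda>y. y"]
    by (auto simp: finite_conjugates conjugates_frob)
  define m where "m = min_poly x"
  have m: "lead_coeff m = 1" "poly (map_poly to_ac m) x = 0"
    "\<And>r. r \<noteq> 0 \<Longrightarrow> poly (map_poly to_ac r) x = 0 \<Longrightarrow> degree m \<le> degree r"
    using min_poly[of x] by (auto simp: is_min_poly_def m_def)
  have degree_p: "degree p = card (conjugates x)"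
    using arg_cong[OF p, of degree] by (simp add: degree_prod_eq_sum_degree)
  have "to_ac (lead_coeff p) = lead_coeff (map_poly to_ac p)" by (simp add: coeff_map_poly)
  also have "\<dots> = 1" unfolding p lead_coeff_prod by simp
  finally have lead_p: "lead_coeff p = 1" by (metis to_ac_1 to_ac_eq_iff)
  have root_p: "poly (map_poly to_ac p) x = 0"
    unfolding p poly_prod using self_in_conjugates finite_conjugates by (intro prod_zero) auto
  have "degree m \<le> degree p" using lead_p root_p by (intro m(3)) auto
  moreover have "degree p \<le> degree m"
    unfolding degree_p using m(1,2) by (intro card_conjugates_le) auto
  ultimately have deg: "degree m = degree p" by simp
  have "m = p"
  proof (rule ccontr)
    assume "m \<noteq> p"
    have "degree (m - p) < degree m"
      using deg lead_p m(1) degree_p card_conjugates_pos[of x] by (intro degree_diff_less_lead) auto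
    moreover have "degree m \<le> degree (m - p)"
      using \<open>m \<noteq> p\<close> m(2) root_p by (intro m(3)) (auto simp: map_poly_to_ac_diff)
    ultimately show False by simp
  qed
  thus ?thesis using p by (simp add: m_def)
qed

lemma degree_min_poly: "degree (min_poly x) = card (conjugates x)"
  using arg_cong[OF min_poly_eq_prod_conjugates, of degree]
  by (simp add: degree_prod_eq_sum_degree)

text \<open>In a factorization one factor vanishes at \<open>x\<close>, so its degree is at least
  the orbit size and the other factor is constant.\<close>

lemma irreducible_min_poly: "Factorial_Ring.irreducible (min_poly (x :: 'a alg_closure))"
proof (rule Factorial_Ring.irreducibleI)
  define m where "m = min_poly x"
  have nz: "min_poly x \<noteq> 0" using degree_min_poly[of x] card_conjugates_pos[of x] by auto
  thus "min_poly x \<noteq> 0" .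
  show "\<not> is_unit (min_poly x)"
    using degree_min_poly[of x] card_conjugates_pos[of x] by (auto simp: is_unit_iff_degree nz)
  fix a b assume ab: "min_poly x = a * b"
  hence nz': "a \<noteq> 0" "b \<noteq> 0" using nz by auto
  have "poly (map_poly to_ac (a * b)) x = 0"
    using min_poly[of x] ab by (simp add: is_min_poly_def)
  hence "poly (map_poly to_ac a) x = 0 \<or> poly (map_poly to_ac b) x = 0"
    by (simp add: map_poly_to_ac_mult)
  moreover have "degree a + degree b = card (conjugates x)"
    using degree_min_poly[of x] nz' by (simp add: ab degree_mult_eq)
  ultimately have "degree b = 0 \<or> degree a = 0"
    using card_conjugates_le nz' by fastforce
  thus "is_unit a \<or> is_unit b" using nz' by (auto simp: is_unit_iff_degree)
qed

text \<open>Identifies the given factors \<open>f i\<close> with minimal polynomials: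
  \<open>min_poly x\<close> divides \<open>f\<close>, so irreducibility makes them associates, and
  both are monic.\<close>

lemma irreducible_eq_min_poly:
  assumes "Factorial_Ring.irreducible f" "lead_coeff f = 1" "poly (map_poly to_ac f) x = 0"
  shows   "f = min_poly (x :: 'a alg_closure)"
proof -
  define m where "m = min_poly x"
  have m: "lead_coeff m = 1" "poly (map_poly to_ac m) x = 0"
    using min_poly[of x] by (auto simp: is_min_poly_def m_def)
  have deg: "degree m = card (conjugates x)" by (simp add: m_def degree_min_poly)
  have "f mod m = f - m * (f div m)" by (simp add: minus_mult_div_eq_mod)
  hence "poly (map_poly to_ac (f mod m)) x = 0"
    using assms(3) m(2) by (simp add: map_poly_to_ac_diff map_poly_to_ac_mult)
  \<comment> \<open>A nonzero remainder would vanish at \<open>x\<close> with degree below the orbit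
    size.\<close>
  hence "f mod m = 0"
    using card_conjugates_le[of "f mod m" x] degree_mod_less'[of m f] deg m(1) card_conjugates_pos[of x]
    by fastforce
  hence "m dvd f" by auto
  moreover have "\<not> is_unit m"
    using irreducible_min_poly[of x] by (auto simp: m_def Factorial_Ring.irreducible_def)
  ultimately have "f dvd m" using assms(1) irreducibleD' by blast
  then obtain a where a: "m = f * a" by (elim dvdE)
  have nz: "m \<noteq> 0" "f \<noteq> 0" "a \<noteq> 0" using m(1) assms(2) a by auto
  have "degree m \<le> degree f" using \<open>m dvd f\<close> nz by (intro dvd_imp_degree_le) auto
  hence "degree a = 0" using nz by (simp add: a degree_mult_eq)
  then obtain c where "a = [:c:]" by (elim degree_eq_zeroE)
  with a m(1) assms(2) have "a = 1" by (auto simp: one_pCons split: if_splits)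
  with a show ?thesis by (simp add: m_def)
qed

text \<open>The power \<open>x ^ (Q ^ j)\<close> depends only on \<open>Q ^ j\<close> modulo
  \<open>n\<close>, so the orbit is as long as the cycle of powers of \<open>Q\<close> modulo
  \<open>n\<close>.\<close>

lemma card_conjugates_prim_root:
  assumes "x \<in> prim_roots n" "n > 0" "coprime n Q"
  shows   "card (conjugates x) = ord n Q" 
proof -
  have eq: "x ^ (Q ^ i) = x ^ (Q ^ j) \<longleftrightarrow> [i = j] (mod ord n Q)" for i j
    using prim_roots_power_eq_iff[OF assms(1,2)] order_divides_expdiff[OF assms(3)] by simp
  have pos: "ord n Q > 0" using assms(3) by simp
  have "conjugates x = (\<lambda>j. x ^ (Q ^ j)) ` {..<ord n Q}"
  proof (intro equalityI subsetI)
    fix y assume "y \<in> conjugates x"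
    then obtain j where "y = x ^ (Q ^ j)" by (auto simp: conjugates_def)
    hence "y = x ^ (Q ^ (j mod ord n Q))" using eq[of j "j mod ord n Q"] by (simp add: cong_def)
    thus "y \<in> (\<lambda>j. x ^ (Q ^ j)) ` {..<ord n Q}" using pos by auto
  qed (auto simp: conjugates_def)
  moreover have "inj_on (\<lambda>j. x ^ (Q ^ j)) {..<ord n Q}"
    by (rule inj_onI) (auto simp: eq cong_less_modulus_unique_nat)
  ultimately show ?thesis by (simp add: card_image)
qed

end

subsection \<open>Multiplicative Moebius inversion\<close>

lemma moebius_mu_prime_mult:
  assumes "Factorial_Ring.prime p" "\<not> p dvd d" "d > 0"
  shows   "moebius_mu (p * d) = - moebius_mu d"
proof (cases "squarefree d")
  case True
  have "coprime p d" using assms by (simp add: prime_imp_coprime)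
  hence "squarefree (p * d)"
    using True assms(1) by (intro squarefree_mult_coprime) (auto intro: squarefree_prime)
  moreover have "prime_factors (p * d) = insert p (prime_factors d)"
    using assms by (subst prime_factors_product) (auto simp: prime_prime_factors)
  ultimately show ?thesis using True assms by (simp add: moebius_mu_def in_prime_factors_iff)
next
  case False
  hence "\<not> squarefree (p * d)" using squarefree_multD(2) by blast
  with False show ?thesis by (simp add: moebius_mu_def)
qed

text \<open>For a prime \<open>p\<close> dividing \<open>n\<close>, each squarefree divisor
  \<open>d\<close> prime to \<open>p\<close> is paired with \<open>p * d\<close>; the two values
  cancel, and all other divisors contribute \<open>0\<close>.\<close>

lemma sum_moebius_mu:
  assumes "n > 0"
  shows   "(\<Sum>d | d dvd n. moebius_mu d) = (if n = 1 then 1 else 0)"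
proof (cases "n = 1")
  case True
  have "{d :: nat. d dvd 1} = {1}" by auto
  with True show ?thesis by (simp add: moebius_mu_def)
next
  case False
  then obtain p where p: "Factorial_Ring.prime p" "p dvd n"
    using prime_factor_nat by blast
  define B where "B = {d. d dvd n \<and> squarefree d \<and> \<not> p dvd d}"
  have fin: "finite {d. d dvd n}" using assms by simp
  have B: "d dvd n" "d > 0" "\<not> p dvd d" if "d \<in> B" for d
    using that assms by (auto simp: B_def intro!: Nat.gr0I)
  have finB: "finite B" unfolding B_def by (rule finite_subset[OF _ fin]) auto
  have pB: "p * d dvd n" if "d \<in> B" for d
    using p B[OF that] by (intro divides_mult prime_imp_coprime) auto
  have "(\<Sum>d | d dvd n. moebius_mu d) = (\<Sum>d\<in>B \<union> (*) p ` B. moebius_mu d)"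
  proof (rule sum.mono_neutral_right[OF fin])
    show "B \<union> (*) p ` B \<subseteq> {d. d dvd n}" using B(1) pB by auto
    show "\<forall>d\<in>{d. d dvd n} - (B \<union> (*) p ` B). moebius_mu d = 0"
    proof
      fix d assume d: "d \<in> {d. d dvd n} - (B \<union> (*) p ` B)"
      show "moebius_mu d = 0"
      proof (cases "squarefree d")
        case True
        with d have "p dvd d" by (auto simp: B_def)
        then obtain e where e: "d = p * e" by (elim dvdE)
        have "\<not> p dvd e"
        proof
          assume "p dvd e"
          hence "p ^ 2 dvd d" by (simp add: e power2_eq_square)
          with True have "p dvd 1" by (rule squarefreeD)
          thus False using p(1) by simp
        qed
        moreover have "squarefree e" using True squarefree_multD(2) e by blast
        moreover have "e dvd n" using d e dvd_mult_right[of p e n] by simp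
        ultimately have "e \<in> B" by (simp add: B_def)
        with d e show ?thesis by auto
      qed (simp add: moebius_mu_def)
    qed
  qed
  also have "\<dots> = (\<Sum>d\<in>B. moebius_mu d) + (\<Sum>d\<in>(*) p ` B. moebius_mu d)"
    using finB by (intro sum.union_disjoint) (auto simp: B_def)
  also have "(\<Sum>d\<in>(*) p ` B. moebius_mu d) = (\<Sum>d\<in>B. moebius_mu (p * d))"
    using prime_gt_0_nat[OF p(1)] by (subst sum.reindex) (auto intro!: inj_onI)
  also have "\<dots> = - (\<Sum>d\<in>B. moebius_mu d)"
    unfolding sum_negf[symmetric] using B p(1) by (intro sum.cong refl moebius_mu_prime_mult) auto
  finally show ?thesis using False by simp
qed

lemma prod_power_int: "(\<Prod>i\<in>A. f i) powi k = (\<Prod>i\<in>A. f i powi k :: 'b :: field)"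
  by (induction A rule: infinite_finite_induct) (simp_all add: power_int_mult_distrib)

lemma power_int_sum: "x \<noteq> 0 \<Longrightarrow> x powi (\<Sum>i\<in>A. k i) = (\<Prod>i\<in>A. (x :: 'b :: field) powi k i)"
  by (induction A rule: infinite_finite_induct) (simp_all add: power_int_add)

text \<open>After exchanging the products, the exponent of \<open>G e\<close> is the sum of
  \<open>moebius_mu\<close> over the divisors of \<open>n div e\<close>, which is \<open>0\<close>
  unless \<open>e = n\<close>. Nonvanishing of \<open>G\<close> lets the possibly negative exponents
  be added.\<close>

lemma moebius_inversion_prod:
  fixes F G :: "nat \<Rightarrow> 'b :: field"
  assumes "n > 0"
    and F: "\<And>d. d dvd n \<Longrightarrow> F d = (\<Prod>e | e dvd d. G e)"
    and G: "\<And>d. d dvd n \<Longrightarrow> G d \<noteq> 0"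
  shows "(\<Prod>d | d dvd n. F d powi moebius_mu (n div d)) = G n"
proof -
  define D where "D = {d. d dvd n}"
  have fin: "finite D" using assms(1) by (simp add: D_def)
  have "(\<Prod>d\<in>D. F d powi moebius_mu (n div d)) =
        (\<Prod>d\<in>D. \<Prod>e\<in>{e. e \<in> D \<and> e dvd d}. G e powi moebius_mu (n div d))"
    by (intro prod.cong refl, subst F)
       (auto simp: D_def prod_power_int intro!: prod.cong intro: dvd_trans)
  also have "\<dots> = (\<Prod>e\<in>D. \<Prod>d\<in>{d. d \<in> D \<and> e dvd d}. G e powi moebius_mu (n div d))"
    by (rule prod.swap_restrict[OF fin fin])
  also have "\<dots> = (\<Prod>e\<in>D. if e = n then G e else 1)"
  proof (intro prod.cong refl)
    fix e assume "e \<in> D"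
    then obtain c where c: "n = e * c" by (auto simp: D_def elim: dvdE)
    hence pos: "e > 0" "c > 0" using assms(1) by auto
    have "(\<Sum>d\<in>{d. d \<in> D \<and> e dvd d}. moebius_mu (n div d)) = (\<Sum>k | k dvd c. moebius_mu k)"
      by (rule sum.reindex_bij_witness[of _ "\<lambda>k. n div k" "\<lambda>d. n div d"])
         (use pos in \<open>auto simp: D_def c elim!: dvdE\<close>)
    also have "\<dots> = (if c = 1 then 1 else 0)" by (rule sum_moebius_mu[OF pos(2)])
    also have "c = 1 \<longleftrightarrow> e = n" using pos by (auto simp: c)
    finally show "(\<Prod>d\<in>{d. d \<in> D \<and> e dvd d}. G e powi moebius_mu (n div d)) = (if e = n then G e else 1)"
      using G[of e] \<open>e \<in> D\<close> by (simp add: D_def flip: power_int_sum)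
  qed
  also have "\<dots> = G n" using fin by (simp add: prod.delta D_def)
  finally show ?thesis by (simp add: D_def)
qed

lemma to_fract_prod: "to_fract (\<Prod>i\<in>A. f i) = (\<Prod>i\<in>A. to_fract (f i))"
  by (induction A rule: infinite_finite_induct) simp_all

subsection \<open>The factorization of the cyclotomic polynomial\<close>

context finite_field_closure
begin

lemma conjugates_subset_prim_roots:
  assumes "x \<in> prim_roots n" "coprime n Q"
  shows   "conjugates x \<subseteq> prim_roots n"
  using assms by (intro conjugates_subset prim_roots_power)

lemma conjugates_power: "conjugates (x ^ d) = (\<lambda>a. a ^ d) ` conjugates x"
  unfolding conjugates_def image_image by (simp add: mult.commute flip: power_mult)

text \<open>Provides the polynomials \<open>G\<^sub>e\<close> over the base field: Frobenius
  permutes the orbit and the roots of unity separately, hence also the pairs.\<close>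

lemma descend_twisted_cyclotomic:
  assumes "coprime n Q"
  shows   "\<exists>p :: 'a poly. map_poly to_ac p = (\<Prod>a\<in>conjugates x. \<Prod>b\<in>prim_roots n. [:-(a * b), 1:])"
proof -
  have "bij_betw (\<lambda>b :: 'a alg_closure. b ^ Q) (prim_roots n) (prim_roots n)"
    using assms by (intro bij_betw_frob finite_prim_roots of_nat_nonzero prim_roots_power)
  moreover have "bij_betw (\<lambda>b. b ^ Q) (conjugates x) (conjugates x)"
    by (intro bij_betw_frob finite_conjugates conjugates_frob)
  ultimately have "bij_betw (map_prod (\<lambda>a. a ^ Q) (\<lambda>b :: 'a alg_closure. b ^ Q))
      (conjugates x \<times> prim_roots n) (conjugates x \<times> prim_roots n)"
    by (intro bij_betw_map_prod)
  from descend_prod_linear[OF this, of "\<lambda>(a, b). a * b"]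
  have "\<exists>p :: 'a poly. map_poly to_ac p = (\<Prod>(a, b)\<in>conjugates x \<times> prim_roots n. [:-(a * b), 1:])"
    by (auto simp: power_mult_distrib case_prod_unfold)
  thus ?thesis by (simp add: prod.cartesian_product)
qed

text \<open>As \<open>n\<close> and \<open>d\<close> are coprime, \<open>d\<close>-th powers stay
  distinct on the orbit, so each conjugate \<open>a\<close> contributes exactly one factor
  \<open>x^d - a^d\<close>; splitting these by order and swapping the products gives the
  claim.\<close>

lemma pcompose_min_poly_power:
  assumes "x \<in> prim_roots n" "n > 0" "coprime n Q" "coprime n d" "coprime d Q"
  shows   "map_poly to_ac (pcompose (min_poly (x ^ d)) (monom 1 d)) =
             (\<Prod>e | e dvd d. \<Prod>a\<in>conjugates x. \<Prod>b\<in>prim_roots e. [:-(a * b), 1:])"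
proof -
  have sub: "conjugates x \<subseteq> prim_roots n"
    using assms by (intro conjugates_subset_prim_roots)
  have "map_poly to_ac (pcompose (min_poly (x ^ d)) (monom 1 d)) =
        (\<Prod>y\<in>(\<lambda>a. a ^ d) ` conjugates x. monom 1 d - [:y:])"
    by (simp add: map_poly_to_ac_pcompose_monom min_poly_eq_prod_conjugates conjugates_power
          pcompose_prod pcompose_pCons)
       (intro prod.cong refl, simp add: diff_conv_add_uminus add.commute)
  also have "\<dots> = (\<Prod>a\<in>conjugates x. monom 1 d - [:a ^ d:])"
    using inj_on_subset[OF inj_on_power_prim_roots[OF assms(4,2)] sub] by (simp add: prod.reindex)
  also have "\<dots> = (\<Prod>a\<in>conjugates x. \<Prod>e | e dvd d. \<Prod>b\<in>prim_roots e. [:-(a * b), 1:])"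
    using sub prim_roots_nonzero[OF _ assms(2)] of_nat_nonzero[OF assms(5)]
    by (intro prod.cong refl monom_minus_power_eq_prod_prim_roots) auto
  also have "\<dots> = (\<Prod>e | e dvd d. \<Prod>a\<in>conjugates x. \<Prod>b\<in>prim_roots e. [:-(a * b), 1:])"
    by (rule prod.swap)
  finally show ?thesis .
qed

text \<open>For a primitive root the orbit length \<open>ord m Q\<close> equals the total number
  \<open>totient m\<close> of available elements.\<close>

lemma conjugates_primroot:
  assumes "y \<in> prim_roots m" "residue_primroot m Q"
  shows   "conjugates y = prim_roots m"
proof (rule card_subset_eq)
  have m: "m > 0" "coprime m Q" "ord m Q = totient m"
    using assms(2) by (auto simp: residue_primroot_def)
  show "finite (prim_roots m :: 'a alg_closure set)"
    using m by (intro finite_prim_roots of_nat_nonzero)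
  show "conjugates y \<subseteq> prim_roots m"
    using assms m by (intro conjugates_subset_prim_roots)
  show "card (conjugates y) = card (prim_roots m :: 'a alg_closure set)"
    using assms m by (simp add: card_conjugates_prim_root card_prim_roots of_nat_nonzero)
qed

text \<open>One inclusion holds because the set of products is Frobenius-stable; the other combines
  independent Frobenius powers on the two factors into one.\<close>

lemma conjugates_times:
  assumes x: "x \<in> prim_roots n" and y: "y \<in> prim_roots m"
    and "n > 0" "coprime n Q" "residue_primroot m Q" "coprime (totient m) (ord n Q)"
  shows   "conjugates (x * y) = (\<lambda>(a, b). a * b) ` (conjugates x \<times> prim_roots m)"
proof (intro equalityI conjugates_subset)
  have m: "m > 0" "coprime m Q" "ord m Q = totient m"
    using assms(5) by (auto simp: residue_primroot_def)
  show "x * y \<in> (\<lambda>(a, b). a * b) ` (conjugates x \<times> prim_roots m)"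
    using y self_in_conjugates by auto
  show "z ^ Q \<in> (\<lambda>(a, b). a * b) ` (conjugates x \<times> prim_roots m)"
    if "z \<in> (\<lambda>(a, b). a * b) ` (conjugates x \<times> prim_roots m)" for z
  proof -
    from that obtain a b where "a \<in> conjugates x" "b \<in> prim_roots m" "z = a * b" by auto
    hence "z ^ Q = a ^ Q * b ^ Q" "a ^ Q \<in> conjugates x" "b ^ Q \<in> prim_roots m"
      using m by (auto simp: power_mult_distrib conjugates_frob prim_roots_power)
    thus ?thesis by force
  qed
  show "(\<lambda>(a, b). a * b) ` (conjugates x \<times> prim_roots m) \<subseteq> conjugates (x * y)"
  proof clarify
    fix a b :: "'a alg_closure" assume "a \<in> conjugates x" "b \<in> prim_roots m"
    hence "a \<in> conjugates x" "b \<in> conjugates y"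
      using conjugates_primroot[OF y assms(5)] by simp_all
    then obtain i j where ij: "a = x ^ (Q ^ i)" "b = y ^ (Q ^ j)"
      unfolding conjugates_def by blast
    have "coprime (ord n Q) (ord m Q)" using assms(6) m(3) by (simp add: coprime_commute)
    \<comment> \<open>As the orbit lengths are coprime, a single exponent \<open>s\<close> acts as
      \<open>i\<close> on \<open>x\<close> and as \<open>j\<close> on \<open>y\<close>.\<close>
    then obtain s where s: "[s = i] (mod ord n Q)" "[s = j] (mod ord m Q)"
      using binary_chinese_remainder_nat by blast
    have "x ^ (Q ^ s) = a"
      using s(1) by (simp add: ij prim_roots_power_eq_iff[OF x] order_divides_expdiff assms(3,4))
    moreover have "y ^ (Q ^ s) = b"
      using s(2) by (simp add: ij prim_roots_power_eq_iff[OF y] order_divides_expdiff m(1,2))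
    ultimately have "a * b = (x * y) ^ (Q ^ s)" by (simp add: power_mult_distrib)
    thus "a * b \<in> conjugates (x * y)" by (auto simp: conjugates_def)
  qed
qed

text \<open>Coprimality of \<open>n\<close> and \<open>m\<close> makes multiplication injective on
  pairs, so the product over the orbit of \<open>x * y\<close> is exactly the double product
  defining \<open>G\<^sub>m\<close>.\<close>

lemma min_poly_times:
  assumes x: "x \<in> prim_roots n" and y: "y \<in> prim_roots m"
    and "n > 0" "coprime n Q" "coprime n m" "residue_primroot m Q" "coprime (totient m) (ord n Q)"
  shows "map_poly to_ac (min_poly (x * y)) =
           (\<Prod>a\<in>conjugates x. \<Prod>b\<in>prim_roots m. [:-(a * b), 1:])"
proof -
  have m: "coprime m Q" using assms(6) by (auto simp: residue_primroot_def)
  have nz: "of_nat (n * m) \<noteq> (0 :: 'a alg_closure)"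
    using assms(4) m by (intro of_nat_nonzero) simp
  have "inj_on (\<lambda>(a, b). a * b) (conjugates x \<times> prim_roots m)"
    by (rule inj_on_subset[OF bij_betw_imp_inj_on[OF bij_betw_times_prim_roots[OF nz assms(5)]]])
       (use conjugates_subset_prim_roots[OF x assms(4)] in auto)
  hence "(\<Prod>z\<in>conjugates (x * y). [:-z, 1:]) =
         (\<Prod>(a, b)\<in>conjugates x \<times> prim_roots m. [:-(a * b), 1:])"
    unfolding conjugates_times[OF x y assms(3,4,6,7)]
    by (subst prod.reindex) (simp_all add: case_prod_unfold)
  thus ?thesis by (simp add: min_poly_eq_prod_conjugates prod.cartesian_product)
qed

text \<open>The orbits of the chosen roots partition \<open>prim_roots n\<close>. Covering comes
  from comparing roots, disjointness from counting, so distinctness of the factors is a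
  consequence.\<close>

lemma bij_betw_Sigma_conjugates:
  fixes \<xi> :: "'i \<Rightarrow> 'a alg_closure"
  assumes "finite I" "card I * ord n Q = totient n" "n > 0" "coprime n Q"
    and cyc: "cyclotomic n = (\<Prod>i\<in>I. min_poly (\<xi> i))"
  shows   "bij_betw snd (SIGMA i:I. conjugates (\<xi> i)) (prim_roots n)"
proof -
  have nz: "of_nat n \<noteq> (0 :: 'a alg_closure)" using assms(4) by (rule of_nat_nonzero)
  have fin: "finite (prim_roots n :: 'a alg_closure set)" using nz by (rule finite_prim_roots)
  have lift: "(\<Prod>x\<in>prim_roots n. [:-x, 1 :: 'a alg_closure:]) =
        (\<Prod>i\<in>I. \<Prod>x\<in>conjugates (\<xi> i). [:-x, 1:])"
    using arg_cong[OF cyc, of "map_poly to_ac"]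
    by (simp add: map_poly_to_ac_cyclotomic cyclotomic_eq_prod_prim_roots[OF nz]
          map_poly_to_ac_prod min_poly_eq_prod_conjugates)
  \<comment> \<open>Comparing zeros yields only equality of root sets; multiplicities are settled by
    the cardinalities below.\<close>
  have "x \<in> prim_roots n \<longleftrightarrow> (\<exists>i\<in>I. x \<in> conjugates (\<xi> i))" for x
    using arg_cong[OF lift, of "\<lambda>p. poly p x = 0"] fin assms(1) finite_conjugates
    by (simp add: poly_prod prod_zero_iff)
  hence surj: "snd ` (SIGMA i:I. conjugates (\<xi> i)) = prim_roots n" by force
  hence "card (conjugates (\<xi> i)) = ord n Q" if "i \<in> I" for i
    using that self_in_conjugates[of "\<xi> i"] assms(3,4) by (intro card_conjugates_prim_root) force+
  hence "card (SIGMA i:I. conjugates (\<xi> i)) = card (prim_roots n :: 'a alg_closure set)"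
    using assms(1,2) by (simp add: card_SigmaI finite_conjugates card_prim_roots[OF nz])
  moreover have "finite (SIGMA i:I. conjugates (\<xi> i))"
    using assms(1) finite_conjugates by auto
  ultimately show ?thesis
    unfolding bij_betw_def using surj by (metis eq_card_imp_inj_on)
qed

end

text \<open>The identity lives in the field of fractions because \<open>moebius_mu\<close> can be
  \<open>-1\<close>; the second conjunct says that each inner product is nevertheless an irreducible
  polynomial.\<close>

theorem theorem3p3:
  fixes q m n :: nat
    and f :: "nat \<Rightarrow> 'a :: {field, finite} poly"
    and \<xi> :: "nat \<Rightarrow> 'a alg_closure"
    and \<Psi> :: "nat \<Rightarrow> nat \<Rightarrow> 'a poly"
  assumes "primepow q" and "card (UNIV :: 'a set) = q"
    and "m > 0" and "n > 0"
    and "coprime n q" and "coprime m n" and "coprime (totient m) (ord n q)"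
    and "residue_primroot m q"
    and "\<And>i. i \<in> {1..totient n div ord n q} \<Longrightarrow> lead_coeff (f i) = 1 \<and> Factorial_Ring.irreducible (f i)"
    and "cyclotomic n = (\<Prod>i = 1..totient n div ord n q. f i)"
    and "\<And>i. i \<in> {1..totient n div ord n q} \<Longrightarrow> poly (map_poly to_ac (f i)) (\<xi> i) = 0"
    and "\<And>i d. i \<in> {1..totient n div ord n q} \<Longrightarrow> d dvd m \<Longrightarrow> \<Psi> i d = min_poly (\<xi> i ^ d)"
  shows "(to_fract (cyclotomic (m * n)) =
           (\<Prod>i = 1..totient n div ord n q. \<Prod>d | d dvd m.
              to_fract (pcompose (\<Psi> i d) (monom 1 d)) powi moebius_mu (m div d))) \<and>
         (\<forall>i \<in> {1..totient n div ord n q}. \<exists>g :: 'a poly. Factorial_Ring.irreducible g \<and>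
           (\<Prod>d | d dvd m. to_fract (pcompose (\<Psi> i d) (monom 1 d)) powi moebius_mu (m div d)) =
             to_fract g)"
proof -
  interpret finite_field_closure q "TYPE('a)"
    using assms(1,2) by unfold_locales simp_all
  define I where "I = {1..totient n div ord n q}"
  have mq: "coprime m q" using assms(8) by (simp add: residue_primroot_def)
  have nz: "of_nat (n * m) \<noteq> (0 :: 'a alg_closure)"
    using mq assms(5) by (intro of_nat_nonzero) simp
  have f: "f i = min_poly (\<xi> i)" if "i \<in> I" for i
    using assms(9,11) that unfolding I_def by (intro irreducible_eq_min_poly) auto
  have bij: "bij_betw snd (SIGMA i:I. conjugates (\<xi> i)) (prim_roots n)"
  proof (rule bij_betw_Sigma_conjugates)
    \<comment> \<open>The order divides \<open>totient n\<close>, so the division in the index range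
      is exact.\<close>
    show "card I * ord n q = totient n"
      using order_divides_totient[OF assms(5)] by (simp add: I_def)
    show "cyclotomic n = (\<Prod>i\<in>I. min_poly (\<xi> i))"
      using assms(10) f by (simp add: I_def)
  qed (use assms in \<open>auto simp: I_def\<close>)
  have \<xi>: "\<xi> i \<in> prim_roots n" if "i \<in> I" for i
    using bij_betw_imp_surj_on[OF bij] that self_in_conjugates[of "\<xi> i"] by force
  have "totient m > 0" using assms(3) by simp
  hence "(prim_roots m :: 'a alg_closure set) \<noteq> {}"
    using card_prim_roots[OF of_nat_nonzero[OF mq]] by auto
  then obtain \<eta> :: "'a alg_closure" where \<eta>: "\<eta> \<in> prim_roots m" by blast
  \<comment> \<open>The choice is meaningful for \<open>e dvd m\<close>, where \<open>e\<close> is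
    coprime to \<open>q\<close> and the double product descends.\<close>
  define G where "G i e = (SOME p :: 'a poly. map_poly to_ac p =
      (\<Prod>a\<in>conjugates (\<xi> i). \<Prod>b\<in>prim_roots e. [:-(a * b), 1:]))" for i e
  have G: "map_poly to_ac (G i e) = (\<Prod>a\<in>conjugates (\<xi> i). \<Prod>b\<in>prim_roots e. [:-(a * b), 1:])"
    if "e dvd m" for i e
    unfolding G_def using coprime_divisors[OF that dvd_refl mq]
    by (intro someI_ex[OF descend_twisted_cyclotomic])
  \<comment> \<open>Needed for Moebius inversion; the double product is monic.\<close>
  have G_nz: "G i e \<noteq> 0" if "e dvd m" for i e
  proof
    assume "G i e = 0"
    with G[OF that, of i] have "(\<Prod>a\<in>conjugates (\<xi> i). \<Prod>b\<in>prim_roots e. [:-(a * b), 1:]) = 0" by simp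
    hence "lead_coeff (\<Prod>a\<in>conjugates (\<xi> i). \<Prod>b\<in>prim_roots e. [:-(a * b), 1:]) = 0" by simp
    thus False by (simp add: lead_coeff_prod)
  qed
  have \<Psi>: "pcompose (\<Psi> i d) (monom 1 d) = (\<Prod>e | e dvd d. G i e)" if "i \<in> I" "d dvd m" for i d
  proof -
    have "coprime n d" "coprime d q"
      using coprime_divisors[OF that(2) dvd_refl assms(6)] coprime_divisors[OF that(2) dvd_refl mq]
      by (simp_all add: coprime_commute)
    hence "map_poly to_ac (pcompose (min_poly (\<xi> i ^ d)) (monom 1 d)) =
             (\<Prod>e | e dvd d. map_poly to_ac (G i e))"
      using that(2) by (subst pcompose_min_poly_power[OF \<xi>[OF that(1)] assms(4,5)])
        (auto intro!: prod.cong G[symmetric] intro: dvd_trans)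
    hence "map_poly to_ac (pcompose (\<Psi> i d) (monom 1 d)) = map_poly to_ac (\<Prod>e | e dvd d. G i e)"
      using assms(12)[of i d] that by (simp add: I_def map_poly_to_ac_prod)
    thus ?thesis by (simp only: map_poly_to_ac_eq_iff)
  qed
  have inner: "(\<Prod>d | d dvd m. to_fract (pcompose (\<Psi> i d) (monom 1 d)) powi moebius_mu (m div d)) =
                 to_fract (G i m)" if "i \<in> I" for i
    by (rule moebius_inversion_prod) (use assms(3) \<Psi>[OF that] G_nz in \<open>auto simp: to_fract_prod\<close>)
  \<comment> \<open>Any single \<open>\<eta>\<close> of order \<open>m\<close> suffices, since the
    orbit of \<open>\<xi> i * \<eta>\<close> already involves all of
    \<open>prim_roots m\<close>.\<close>
  have "G i m = min_poly (\<xi> i * \<eta>)" if "i \<in> I" for i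
    by (rule iffD1[OF map_poly_to_ac_eq_iff])
       (use min_poly_times[OF \<xi>[OF that] \<eta> assms(4,5) _ assms(8,7)] assms(6) G[of m i] in
         \<open>simp add: coprime_commute\<close>)
  hence irred: "Factorial_Ring.irreducible (G i m)" if "i \<in> I" for i
    using that irreducible_min_poly by simp
  have "map_poly to_ac (cyclotomic (m * n) :: 'a poly) =
        (\<Prod>x\<in>prim_roots (n * m). [:-x, 1:])"
    using cyclotomic_eq_prod_prim_roots[OF nz] by (simp add: map_poly_to_ac_cyclotomic mult.commute)
  also have "\<dots> = (\<Prod>(a, b)\<in>prim_roots n \<times> prim_roots m. [:-(a * b), 1:])"
    using prod.reindex_bij_betw[OF bij_betw_times_prim_roots[OF nz], of "\<lambda>x. [:-x, 1:]"] assms(6)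
    by (simp add: coprime_commute case_prod_unfold)
  also have "\<dots> = (\<Prod>a\<in>prim_roots n. \<Prod>b\<in>prim_roots m. [:-(a * b), 1:])"
    by (simp add: prod.cartesian_product)
  \<comment> \<open>The elements of order \<open>n\<close> are regrouped into the orbits of the
    \<open>\<xi> i\<close>, one for each factor \<open>f i\<close>.\<close>
  also have "\<dots> = (\<Prod>(i, a)\<in>(SIGMA i:I. conjugates (\<xi> i)). \<Prod>b\<in>prim_roots m. [:-(a * b), 1:])"
    using prod.reindex_bij_betw[OF bij, of "\<lambda>a. \<Prod>b\<in>prim_roots m. [:-(a * b), 1:]"]
    by (simp add: case_prod_unfold)
  also have "\<dots> = (\<Prod>i\<in>I. \<Prod>a\<in>conjugates (\<xi> i). \<Prod>b\<in>prim_roots m. [:-(a * b), 1:])"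
    by (rule prod.Sigma[symmetric]) (auto simp: I_def finite_conjugates)
  also have "\<dots> = map_poly to_ac (\<Prod>i\<in>I. G i m)"
    by (simp add: map_poly_to_ac_prod G)
  finally have "cyclotomic (m * n) = (\<Prod>i\<in>I. G i m)" by simp
  hence "to_fract (cyclotomic (m * n)) = (\<Prod>i\<in>I. \<Prod>d | d dvd m.
      to_fract (pcompose (\<Psi> i d) (monom 1 d)) powi moebius_mu (m div d))"
    by (simp add: to_fract_prod inner)
  thus ?thesis using inner irred unfolding I_def by blast
qed

end
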